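(* Let $G_1$ and $G_2$ be finitely generated commensurable groups. If $G_1$ is weakly periodic, then $G_2$ is weakly periodic.
   Context: Let $G$ be a group and $A$ a finite discrete set (an alphabet). The full shift $A^G$ is the set of all functions $G\to A$ (called configurations), with the product topology and the left $G$-action $(gx)(h)=x(g^{-1}h)$. A pattern is a function $p:\Omega\to A$ with $\Omega\subset G$ finite; it appears in $x\in A^G$ if $(gx)|_\Omega=p$ for some $g\in G$. A shift of finite type (SFT) over $G$ is a nonempty set of the form $S=\{x\in A^G:\text{ no } p\in P \text{ appears in } x\}$ for some finite alphabet $A$ and some finite set $P$ of patterns (SFTs are nonempty by convention). For $x\in A^G$ let $\mathrm{Stab}_G(x)=\{g\in G: gx=x\}$. A configuration $x$ is (weakly) periodic if $\mathrm{Stab}_G(x)$ is nontrivial. The group $G$ is weakly periodic if every SFT over $G$ (for every finite alphabet) contains a weakly periodic configuration. Two groups $G_1,G_2$ are commensurable if there is a group $H$ such that each of $G_1$ and $G_2$ has a finite index subgroup isomorphic to $H$. *)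

theory Defs
  imports "HOL-Library.Countable_Set" "HOL-Algebra.Algebra"
begin

text \<open>
  A configuration over the group \<open>G\<close> with alphabet \<open>A\<close> is an element of
  \<open>carrier G \<rightarrow>\<^sub>E A\<close>, that is, a function that is undefined outside the carrier.
\<close>

definition shift :: "('g, 'm) monoid_scheme \<Rightarrow> 'g \<Rightarrow> ('g \<Rightarrow> 'a) \<Rightarrow> 'g \<Rightarrow> 'a" where
  "shift G g x = (\<lambda>h\<in>carrier G. x (inv\<^bsub>G\<^esub> g \<otimes>\<^bsub>G\<^esub> h))"

text \<open>A pattern \<open>p : \<Omega> \<rightarrow> A\<close> is represented by the pair \<open>(\<Omega>, p)\<close>.\<close>

definition patterns :: "('g, 'm) monoid_scheme \<Rightarrow> 'a set \<Rightarrow> ('g set \<times> ('g \<Rightarrow> 'a)) set" where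
  "patterns G A = {(\<Omega>, p). finite \<Omega> \<and> \<Omega> \<subseteq> carrier G \<and> p \<in> \<Omega> \<rightarrow>\<^sub>E A}"

definition appears_in ::
  "('g, 'm) monoid_scheme \<Rightarrow> 'g set \<times> ('g \<Rightarrow> 'a) \<Rightarrow> ('g \<Rightarrow> 'a) \<Rightarrow> bool" where
  "appears_in G P x \<longleftrightarrow> (\<exists>g\<in>carrier G. restrict (shift G g x) (fst P) = snd P)"

definition SFT :: "('g, 'm) monoid_scheme \<Rightarrow> 'a set \<Rightarrow> ('g \<Rightarrow> 'a) set \<Rightarrow> bool" where
  "SFT G A S \<longleftrightarrow> finite A \<and> S \<noteq> {} \<and>
     (\<exists>F. finite F \<and> F \<subseteq> patterns G A \<and>
        S = {x \<in> carrier G \<rightarrow>\<^sub>E A. \<forall>p\<in>F. \<not> appears_in G p x})"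

definition weakly_periodic_config :: "('g, 'm) monoid_scheme \<Rightarrow> ('g \<Rightarrow> 'a) \<Rightarrow> bool" where
  "weakly_periodic_config G x \<longleftrightarrow> stabilizer G (shift G) x \<noteq> {\<one>\<^bsub>G\<^esub>}"

text \<open>
  Alphabets range over the finite sets of natural numbers, since a definition cannot quantify
  over types. The lemma \<open>weakly_periodic_group_any_alphabet\<close> below shows that
  this covers finite alphabets of every type.
\<close>

definition weakly_periodic_group :: "('g, 'm) monoid_scheme \<Rightarrow> bool" where
  "weakly_periodic_group G \<longleftrightarrow>
     (\<forall>(A :: nat set) S. SFT G A S \<longrightarrow> (\<exists>x\<in>S. weakly_periodic_config G x))"

definition finitely_generated_group :: "('g, 'm) monoid_scheme \<Rightarrow> bool" where
  "finitely_generated_group G \<longleftrightarrow>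
     (\<exists>B. finite B \<and> B \<subseteq> carrier G \<and> generate G B = carrier G)"

definition finite_index_subgroup :: "'g set \<Rightarrow> ('g, 'm) monoid_scheme \<Rightarrow> bool" where
  "finite_index_subgroup K G \<longleftrightarrow> subgroup K G \<and> finite (rcosets\<^bsub>G\<^esub> K)"

text \<open>
  The common group \<open>H\<close> may be taken over the element type of the first group, because it
  is isomorphic to a subgroup of that group.
\<close>

definition commensurable :: "('g, 'm) monoid_scheme \<Rightarrow> ('h, 'n) monoid_scheme \<Rightarrow> bool" where
  "commensurable G1 G2 \<longleftrightarrow>
     (\<exists>H :: 'g monoid. group H \<and>
        (\<exists>K. finite_index_subgroup K G1 \<and> G1\<lparr>carrier := K\<rparr> \<cong> H) \<and>
        (\<exists>K. finite_index_subgroup K G2 \<and> G2\<lparr>carrier := K\<rparr> \<cong> H))"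

lemma (in group) shift_closed:
  assumes "g \<in> carrier G" "x \<in> carrier G \<rightarrow>\<^sub>E A"
  shows "shift G g x \<in> carrier G \<rightarrow>\<^sub>E A"
  using assms by (auto simp: shift_def)

lemma (in group) shift_compose:
  assumes "g \<in> carrier G"
  shows "shift G g (compose (carrier G) f x) = compose (carrier G) f (shift G g x)"
  using assms by (auto simp: shift_def compose_def)

lemma (in group) appears_in_compose:
  assumes f: "inj_on f A" and p: "p \<in> patterns G A" and x: "x \<in> carrier G \<rightarrow>\<^sub>E A"
  shows "appears_in G (fst p, compose (fst p) f (snd p)) (compose (carrier G) f x)
           \<longleftrightarrow> appears_in G p x"
proof -
  obtain W q where pq: "p = (W, q)" by (cases p)
  have W: "W \<subseteq> carrier G" and q: "q \<in> W \<rightarrow>\<^sub>E A"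
    using p by (auto simp: pq patterns_def)
  have "restrict (shift G g (compose (carrier G) f x)) W = compose W f q
          \<longleftrightarrow> restrict (shift G g x) W = q" if g: "g \<in> carrier G" for g
  proof -
    have y: "shift G g x \<in> carrier G \<rightarrow>\<^sub>E A" using shift_closed g x .
    have "restrict (shift G g (compose (carrier G) f x)) W = compose W f q
            \<longleftrightarrow> (\<forall>h\<in>W. f (shift G g x h) = f (q h))"
      unfolding shift_compose[OF g] using W
      by (auto simp: fun_eq_iff compose_def restrict_def subset_eq)
    also have "\<dots> \<longleftrightarrow> (\<forall>h\<in>W. shift G g x h = q h)"
      using W y q f by (fastforce dest: inj_onD)
    also have "\<dots> \<longleftrightarrow> restrict (shift G g x) W = q"
      using q by (auto simp: fun_eq_iff restrict_def PiE_def extensional_def)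
    finally show ?thesis .
  qed
  then show ?thesis by (auto simp: appears_in_def pq)
qed

lemma (in group) weakly_periodic_group_any_alphabet:
  fixes A :: "'b set"
  assumes G: "weakly_periodic_group G" and S: "SFT G A S"
  shows "\<exists>x\<in>S. weakly_periodic_config G x"
proof -
  let ?C = "compose (carrier G)"
  from S obtain F where A: "finite A" and ne: "S \<noteq> {}" and F: "finite F" "F \<subseteq> patterns G A"
    and S_eq: "S = {x \<in> carrier G \<rightarrow>\<^sub>E A. \<forall>p\<in>F. \<not> appears_in G p x}"
    by (auto simp: SFT_def)
  obtain f :: "'b \<Rightarrow> nat" where f: "inj_on f A"
    using countable_finite[OF A] by (auto simp: countable_def)
  define \<phi> where "\<phi> = (\<lambda>p :: 'a set \<times> ('a \<Rightarrow> 'b). (fst p, compose (fst p) f (snd p)))"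
  define S' where
    "S' = {y \<in> carrier G \<rightarrow>\<^sub>E f ` A. \<forall>p\<in>\<phi> ` F. \<not> appears_in G p y}"
  have app: "appears_in G (\<phi> p) (?C f x) \<longleftrightarrow> appears_in G p x"
    if "p \<in> F" "x \<in> carrier G \<rightarrow>\<^sub>E A" for p x
    using appears_in_compose[OF f] that F(2) by (auto simp: \<phi>_def)
  have C: "?C f x \<in> carrier G \<rightarrow>\<^sub>E f ` A" if "x \<in> carrier G \<rightarrow>\<^sub>E A" for x
    using that by (auto simp: compose_def)
  have "SFT G (f ` A) S'"
    unfolding SFT_def
  proof (intro conjI exI)
    obtain x where "x \<in> S" using ne by blast
    then have "?C f x \<in> S'" using app C by (simp add: S_eq S'_def)
    then show "S' \<noteq> {}" by blast
    show "\<phi> ` F \<subseteq> patterns G (f ` A)"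
    proof
      fix p' assume "p' \<in> \<phi> ` F"
      then obtain p where "p \<in> F" "p' = \<phi> p" by blast
      then show "p' \<in> patterns G (f ` A)"
        using F(2) by (cases p) (auto simp: \<phi>_def patterns_def compose_def)
    qed
  qed (use A F S'_def in auto)
  then obtain y where y: "y \<in> S'" and per: "weakly_periodic_config G y"
    using G by (auto simp: weakly_periodic_group_def)
  define x where "x = ?C (inv_into A f) y"
  have yP: "y \<in> carrier G \<rightarrow>\<^sub>E f ` A" using y by (simp add: S'_def)
  have xP: "x \<in> carrier G \<rightarrow>\<^sub>E A"
    using yP by (auto simp: x_def compose_def intro!: inv_into_into)
  have "y h = f (inv_into A f (y h))" if "h \<in> carrier G" for h
    using yP that by (metis PiE_mem f_inv_into_f)
  then have yx: "y = ?C f x"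
    using yP by (auto simp: x_def fun_eq_iff compose_def restrict_def PiE_def extensional_def)
  have "x \<in> S" using y app xP by (auto simp: S_eq S'_def yx)
  moreover have "shift G g x = x" if "g \<in> carrier G" "shift G g y = y" for g
    using that shift_compose[of g "inv_into A f" y] by (simp add: x_def)
  moreover have "shift G g y = y" if "g \<in> carrier G" "shift G g x = x" for g
    using that shift_compose[of g f x] by (simp add: yx)
  ultimately have "stabilizer G (shift G) x = stabilizer G (shift G) y" "x \<in> S"
    by (auto simp: stabilizer_def)
  then show ?thesis using per by (auto simp: weakly_periodic_config_def)
qed

end

theory Submission
  imports Defs
begin

text \<open>
  Both directions compare a group \<open>G\<close> with a group \<open>H\<close> embedded in it with finite index image
  \<open>K\<close>. An SFT over \<open>G\<close> is an SFT over \<open>H\<close> whose alphabet consists of the blocks on a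
  transversal of \<open>K\<close>, and a period in \<open>H\<close> is a period in \<open>G\<close>. Conversely, an SFT
  \<open>S\<close> over \<open>H\<close> yields the SFT over \<open>G\<close> of all configurations that restrict to elements of
  \<open>S\<close> on every left coset of \<open>K\<close>. A period of such a configuration could be a torsion element
  of which no nontrivial power lies in a conjugate of \<open>K\<close>; this is excluded by adding a second
  layer \<open>c\<close>, with values in the right cosets of \<open>K\<close>, such that \<open>c (g s) = c g s\<close> for all \<open>s\<close>
  in a finite set of generators. If \<open>c 1 = K a\<close>, then
  every period \<open>k\<close> lies in \<open>a\<inverse> K a\<close>, so the restriction to \<open>a\<inverse> K\<close> has the period
  \<open>a k a\<inverse>\<close>.
\<close>

section \<open>Windows, periods and equivariance in a single group\<close>

lemma (in group) appears_in_iff_translate: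
  assumes "W \<subseteq> carrier G"
  shows "appears_in G (W, p) x \<longleftrightarrow> (\<exists>g\<in>carrier G. (\<lambda>w\<in>W. x (g \<otimes> w)) = p)"
proof -
  have "restrict (shift G g x) W = (\<lambda>w\<in>W. x (inv g \<otimes> w))" for g
    using assms by (auto simp: shift_def fun_eq_iff)
  then show ?thesis
    unfolding appears_in_def by (metis fst_conv snd_conv inv_closed inv_inv)
qed

text \<open>A finite set of forbidden patterns becomes one local rule \<open>Q\<close> on the union
  of their supports. Conversely, finiteness of \<open>A\<close> and \<open>W\<close> leaves only
  finitely many patterns on \<open>W\<close> that violate \<open>Q\<close>, and these are forbidden.
  Later constructions then only have to give a window and a predicate.\<close>

lemma (in group) SFT_iff_window:
  "SFT G A S \<longleftrightarrow> finite A \<and> S \<noteq> {} \<and>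
     (\<exists>W Q. finite W \<and> W \<subseteq> carrier G \<and>
        S = {x \<in> carrier G \<rightarrow>\<^sub>E A. \<forall>g\<in>carrier G. Q (\<lambda>w\<in>W. x (g \<otimes> w))})"
    (is "_ \<longleftrightarrow> _ \<and> _ \<and> ?R")
proof
  assume "SFT G A S"
  then obtain F where A: "finite A" "S \<noteq> {}" and F: "finite F" "F \<subseteq> patterns G A"
    and S: "S = {x \<in> carrier G \<rightarrow>\<^sub>E A. \<forall>p\<in>F. \<not> appears_in G p x}"
    by (auto simp: SFT_def)
  define W where "W = (\<Union>p\<in>F. fst p)"
  define Q where "Q = (\<lambda>q. \<forall>p\<in>F. restrict q (fst p) \<noteq> snd p)"
  have W: "finite W" "W \<subseteq> carrier G"
    using F unfolding W_def patterns_def by fastforce+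
  have "appears_in G p x \<longleftrightarrow>
      (\<exists>g\<in>carrier G. restrict (\<lambda>w\<in>W. x (g \<otimes> w)) (fst p) = snd p)" if "p \<in> F" for p x
  proof -
    have "fst p \<subseteq> W" using that by (auto simp: W_def)
    then have "restrict (\<lambda>w\<in>W. x (g \<otimes> w)) (fst p) = (\<lambda>w\<in>fst p. x (g \<otimes> w))" for g
      by (auto simp: fun_eq_iff)
    then show ?thesis
      using appears_in_iff_translate[of "fst p" "snd p" x] \<open>fst p \<subseteq> W\<close> W by auto
  qed
  then have "S = {x \<in> carrier G \<rightarrow>\<^sub>E A. \<forall>g\<in>carrier G. Q (\<lambda>w\<in>W. x (g \<otimes> w))}"
    unfolding S Q_def by blast
  then show "finite A \<and> S \<noteq> {} \<and> ?R" using A W by blast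
next
  assume "finite A \<and> S \<noteq> {} \<and> ?R"
  then obtain W Q where A: "finite A" "S \<noteq> {}" and W: "finite W" "W \<subseteq> carrier G"
    and S: "S = {x \<in> carrier G \<rightarrow>\<^sub>E A. \<forall>g\<in>carrier G. Q (\<lambda>w\<in>W. x (g \<otimes> w))}"
    by blast
  define F where "F = Pair W ` {p \<in> W \<rightarrow>\<^sub>E A. \<not> Q p}"
  have F: "finite F" "F \<subseteq> patterns G A"
    using A W by (auto simp: F_def patterns_def finite_PiE)
  have "(\<forall>p\<in>F. \<not> appears_in G p x) \<longleftrightarrow> (\<forall>g\<in>carrier G. Q (\<lambda>w\<in>W. x (g \<otimes> w)))"
    if x: "x \<in> carrier G \<rightarrow>\<^sub>E A" for x
  proof -
    have "(\<lambda>w\<in>W. x (g \<otimes> w)) \<in> W \<rightarrow>\<^sub>E A" if "g \<in> carrier G" for g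
      using x that W by (intro restrict_PiE_iff[THEN iffD2] ballI PiE_mem[OF x]) auto
    moreover have "(\<forall>p\<in>F. \<not> appears_in G p x) \<longleftrightarrow>
        (\<forall>p\<in>W \<rightarrow>\<^sub>E A. \<not> Q p \<longrightarrow> (\<forall>g\<in>carrier G. (\<lambda>w\<in>W. x (g \<otimes> w)) \<noteq> p))"
      using W by (auto simp: F_def appears_in_iff_translate)
    ultimately show ?thesis by metis
  qed
  then have "S = {x \<in> carrier G \<rightarrow>\<^sub>E A. \<forall>p\<in>F. \<not> appears_in G p x}"
    unfolding S by (intro Collect_cong conj_cong refl) simp
  then show "SFT G A S" unfolding SFT_def using A F by auto
qed

text \<open>The identity always stabilizes \<open>x\<close>, so a nontrivial stabilizer means one
  further element; passing to its inverse turns the shift into left translation by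
  \<open>k\<close>.\<close>

lemma (in group) weakly_periodic_config_iff:
  assumes x: "x \<in> carrier G \<rightarrow>\<^sub>E A"
  shows "weakly_periodic_config G x \<longleftrightarrow>
    (\<exists>k\<in>carrier G. k \<noteq> \<one> \<and> (\<forall>g\<in>carrier G. x (k \<otimes> g) = x g))"
proof -
  have shift: "shift G (inv k) x = x \<longleftrightarrow> (\<forall>g\<in>carrier G. x (k \<otimes> g) = x g)"
    if "k \<in> carrier G" for k
    using x that by (auto simp: shift_def fun_eq_iff PiE_def extensional_def)
  have "shift G \<one> x = x"
    using shift[of \<one>] by simp
  then have "weakly_periodic_config G x \<longleftrightarrow> (\<exists>k\<in>carrier G. k \<noteq> \<one> \<and> shift G k x = x)"
    by (auto simp: weakly_periodic_config_def stabilizer_def)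
  also have "\<dots> \<longleftrightarrow> (\<exists>k\<in>carrier G. k \<noteq> \<one> \<and> shift G (inv k) x = x)"
    by (metis inv_closed inv_inv inv_one)
  finally show ?thesis using shift by blast
qed

text \<open>
  In \<open>weakly_periodic_group_any_alphabet\<close> the type of the alphabet is tied to that of the record
  extension of \<open>G\<close>; here it is arbitrary.
\<close>

lemma (in group) weakly_periodic_window:
  fixes A :: "'c set"
  assumes wp: "weakly_periodic_group G" and A: "finite A" and W: "finite W" "W \<subseteq> carrier G"
    and V: "V = {x \<in> carrier G \<rightarrow>\<^sub>E A. \<forall>g\<in>carrier G. Q (\<lambda>w\<in>W. x (g \<otimes> w))}" "V \<noteq> {}"
  shows "\<exists>x\<in>V. \<exists>k\<in>carrier G. k \<noteq> \<one> \<and> (\<forall>g\<in>carrier G. x (k \<otimes> g) = x g)"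
proof -
  \<comment> \<open>Letters are coded by natural numbers through \<open>f\<close> and decoded by
    \<open>d\<close>.\<close>
  obtain f :: "'c \<Rightarrow> nat" where f: "inj_on f A"
    using countable_finite[OF A] by (auto simp: countable_def)
  define d where "d = inv_into A f"
  have df: "d (f a) = a" if "a \<in> A" for a
    using that f by (simp add: d_def)
  \<comment> \<open>The redundant inner restriction keeps the condition literally a predicate of the
    window of \<open>y\<close>, as \<open>SFT_iff_window\<close> requires.\<close>
  define Y where "Y = {y \<in> carrier G \<rightarrow>\<^sub>E f ` A.
    \<forall>g\<in>carrier G. Q (\<lambda>w\<in>W. d ((\<lambda>w\<in>W. y (g \<otimes> w)) w))}"
  have Y: "y \<in> Y \<longleftrightarrow> y \<in> carrier G \<rightarrow>\<^sub>E f ` A \<and> (\<forall>g\<in>carrier G. Q (\<lambda>w\<in>W. d (y (g \<otimes> w))))" for y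
    by (simp add: Y_def cong: restrict_cong)
  obtain x where x: "x \<in> carrier G \<rightarrow>\<^sub>E A" "\<And>g. g \<in> carrier G \<Longrightarrow> Q (\<lambda>w\<in>W. x (g \<otimes> w))"
    using V by blast
  have "(\<lambda>g\<in>carrier G. f (x g)) \<in> Y"
  proof -
    have "(\<lambda>w\<in>W. d ((\<lambda>g\<in>carrier G. f (x g)) (g \<otimes> w))) = (\<lambda>w\<in>W. x (g \<otimes> w))"
      if "g \<in> carrier G" for g
      using that W df PiE_mem[OF x(1)] by (auto simp: fun_eq_iff subset_eq)
    then show ?thesis using x by (auto simp: Y)
  qed
  then have "Y \<noteq> {}" by blast
  then have "SFT G (f ` A) Y"
    unfolding SFT_iff_window using A W
    by (intro conjI exI[of _ W] exI[of _ "\<lambda>q. Q (\<lambda>w\<in>W. d (q w))"]) (simp_all add: Y_def)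
  then obtain y where y: "y \<in> Y" "weakly_periodic_config G y"
    using wp by (auto simp: weakly_periodic_group_def)
  then obtain k where k: "k \<in> carrier G" "k \<noteq> \<one>" "\<And>g. g \<in> carrier G \<Longrightarrow> y (k \<otimes> g) = y g"
    using weakly_periodic_config_iff[of y "f ` A"] unfolding Y by blast
  define z where "z = (\<lambda>g\<in>carrier G. d (y g))"
  have "z \<in> carrier G \<rightarrow>\<^sub>E A"
    using y(1) by (auto simp: z_def d_def Y intro!: inv_into_into)
  moreover have "(\<lambda>w\<in>W. z (g \<otimes> w)) = (\<lambda>w\<in>W. d (y (g \<otimes> w)))" if "g \<in> carrier G" for g
    using that W by (auto simp: z_def fun_eq_iff subset_eq)
  ultimately have "z \<in> V" using y(1) by (simp add: V Y)
  moreover have "z (k \<otimes> g) = z g" if "g \<in> carrier G" for g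
    using that k by (simp add: z_def)
  ultimately show ?thesis using k by blast
qed

text \<open>A rule imposed only at generators propagates by induction over words; for an inverse
  letter, apply it at \<open>g s^-1\<close> and cancel \<open>s\<close>. With \<open>B\<close>
  finite, equivariance under the whole group is thus enforced by a finite window.\<close>

lemma (in group) equivariant_on_generate:
  assumes B: "B \<subseteq> carrier G" and c: "\<And>g. g \<in> carrier G \<Longrightarrow> c g \<subseteq> carrier G"
    and step: "\<And>g s. g \<in> carrier G \<Longrightarrow> s \<in> B \<Longrightarrow> c (g \<otimes> s) = c g #> s"
    and k: "k \<in> generate G B" and g: "g \<in> carrier G"
  shows "c (g \<otimes> k) = c g #> k"
  using k g
proof (induction arbitrary: g)
  case one
  then show ?case using c by simp
next
  case (incl s)
  then show ?case using step by simp
next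
  case (inv s)
  then have s: "s \<in> carrier G" using B by auto
  have "c g = c (g \<otimes> inv s) #> s"
    using step[of "g \<otimes> inv s" s] inv s by (simp add: m_assoc)
  then show ?case
    using s c inv.prems by (simp add: coset_mult_assoc)
next
  case (eng k l)
  then have "k \<in> carrier G" "l \<in> carrier G"
    using generate_in_carrier[OF B] by auto
  then show ?case
    using eng c by (simp add: coset_mult_assoc flip: m_assoc)
qed

section \<open>Finite index embeddings\<close>

text \<open>An injective homomorphism in place of an inclusion lets the same \<open>H\<close> sit
  inside groups over different element types.\<close>

locale finite_index_embedding = H: group H + G: group G
  for H :: "('h, 'n) monoid_scheme" and G :: "('g, 'm) monoid_scheme" +
  fixes \<phi>
  assumes hom: "\<phi> \<in> hom H G"
    and inj: "inj_on \<phi> (carrier H)"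
    and finite_index: "finite (rcosets\<^bsub>G\<^esub> (\<phi> ` carrier H))"
begin

lemma group_hom: "group_hom H G \<phi>"
  by (simp add: group_hom_def group_hom_axioms_def hom H.group_axioms G.group_axioms)

lemmas \<phi>_closed [simp] = group_hom.hom_closed[OF group_hom]
lemmas \<phi>_mult [simp] = group_hom.hom_mult[OF group_hom]
lemmas \<phi>_one [simp] = group_hom.hom_one[OF group_hom]

lemma image_subgroup: "subgroup (\<phi> ` carrier H) G"
  using group_hom.img_is_subgroup[OF group_hom] .

definition \<psi> where "\<psi> = inv_into (carrier H) \<phi>"

lemma \<psi>_closed: "g \<in> \<phi> ` carrier H \<Longrightarrow> \<psi> g \<in> carrier H"
  unfolding \<psi>_def by (rule inv_into_into)

lemma \<phi>_\<psi>: "g \<in> \<phi> ` carrier H \<Longrightarrow> \<phi> (\<psi> g) = g"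
  unfolding \<psi>_def by (rule f_inv_into_f)

lemma \<psi>_\<phi>: "h \<in> carrier H \<Longrightarrow> \<psi> (\<phi> h) = h"
  unfolding \<psi>_def by (rule inv_into_f_f[OF inj])

lemma image_mult_iff:
  assumes g: "g \<in> carrier G" and h: "h \<in> carrier H"
  shows "g \<otimes>\<^bsub>G\<^esub> \<phi> h \<in> \<phi> ` carrier H \<longleftrightarrow> g \<in> \<phi> ` carrier H"
proof
  assume "g \<otimes>\<^bsub>G\<^esub> \<phi> h \<in> \<phi> ` carrier H"
  then have "g \<otimes>\<^bsub>G\<^esub> \<phi> h \<otimes>\<^bsub>G\<^esub> inv\<^bsub>G\<^esub> \<phi> h \<in> \<phi> ` carrier H"
    using h by (blast intro: subgroup.m_closed[OF image_subgroup] subgroup.m_inv_closed[OF image_subgroup])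
  then show "g \<in> \<phi> ` carrier H" using g h by (simp add: G.m_assoc)
qed (use h image_subgroup in \<open>auto intro: subgroup.m_closed\<close>)

lemma \<psi>_mult:
  assumes "g \<in> \<phi> ` carrier H" "h \<in> carrier H"
  shows "\<psi> (g \<otimes>\<^bsub>G\<^esub> \<phi> h) = \<psi> g \<otimes>\<^bsub>H\<^esub> h" and "\<psi> (\<phi> h \<otimes>\<^bsub>G\<^esub> g) = h \<otimes>\<^bsub>H\<^esub> \<psi> g"
  using assms by (auto simp: \<psi>_\<phi> simp flip: \<phi>_mult)

section \<open>Descent to the finite index subgroup\<close>

lemma weakly_periodic_subgroup:
  assumes fg: "finitely_generated_group G" and wp: "weakly_periodic_group G"
  shows "weakly_periodic_group H"
  unfolding weakly_periodic_group_def
proof (intro allI impI)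
  fix A :: "nat set" and S
  assume "SFT H A S"
  then obtain W Q where A: "finite A" and ne: "S \<noteq> {}" and W: "finite W" "W \<subseteq> carrier H"
    and S: "S = {x \<in> carrier H \<rightarrow>\<^sub>E A. \<forall>g\<in>carrier H. Q (\<lambda>w\<in>W. x (g \<otimes>\<^bsub>H\<^esub> w))}"
    unfolding H.SFT_iff_window by blast
  obtain B where B: "finite B" "B \<subseteq> carrier G" "generate G B = carrier G"
    using fg by (auto simp: finitely_generated_group_def)
  define K where "K = \<phi> ` carrier H"
  define C where "C = rcosets\<^bsub>G\<^esub> K"
  have K: "subgroup K G" "K \<subseteq> carrier G"
    using image_subgroup subgroup.subset[OF image_subgroup] by (auto simp: K_def)
  have C: "c \<subseteq> carrier G" if "c \<in> C" for c
    using subgroup.rcosets_carrier[OF K(1) G.group_axioms] that by (simp add: C_def)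
  \<comment> \<open>The identity is in the window so that the coset at \<open>g\<close> can be
    compared with the coset at \<open>g s\<close>.\<close>
  define W' where "W' = insert \<one>\<^bsub>G\<^esub> (\<phi> ` W \<union> B)"
  define Q' where "Q' = (\<lambda>q. Q (\<lambda>w\<in>W. fst (q (\<phi> w))) \<and>
    (\<forall>s\<in>B. snd (q s) = snd (q \<one>\<^bsub>G\<^esub>) #>\<^bsub>G\<^esub> s))"
  define V where "V = {z \<in> carrier G \<rightarrow>\<^sub>E (A \<times> C).
    \<forall>g\<in>carrier G. Q' (\<lambda>w\<in>W'. z (g \<otimes>\<^bsub>G\<^esub> w))}"
  have W': "finite W'" "W' \<subseteq> carrier G" using W B by (auto simp: W'_def)
  have Q'_iff: "Q' (\<lambda>w\<in>W'. z (g \<otimes>\<^bsub>G\<^esub> w)) \<longleftrightarrow>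
      Q (\<lambda>w\<in>W. fst (z (g \<otimes>\<^bsub>G\<^esub> \<phi> w))) \<and> (\<forall>s\<in>B. snd (z (g \<otimes>\<^bsub>G\<^esub> s)) = snd (z g) #>\<^bsub>G\<^esub> s)"
    if "g \<in> carrier G" for g z
  proof -
    have "(\<lambda>w\<in>W. fst ((\<lambda>w\<in>W'. z (g \<otimes>\<^bsub>G\<^esub> w)) (\<phi> w))) = (\<lambda>w\<in>W. fst (z (g \<otimes>\<^bsub>G\<^esub> \<phi> w)))"
      by (auto simp: W'_def fun_eq_iff)
    then show ?thesis using that by (auto simp: Q'_def W'_def)
  qed
  have "V \<noteq> {}"
  proof -
    obtain x where x: "x \<in> S" using ne by blast
    \<comment> \<open>Every \<open>g\<close> factors as \<open>r g\<close> times
      \<open>\<phi> (\<eta> g)\<close>, with \<open>r g\<close> a representative of the left coset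
      \<open>g K\<close>. The choice depends on that coset only, so right multiplication by
      \<open>\<phi> h\<close> changes just the \<open>H\<close>-coordinate.\<close>
    define r where "r g = (SOME t. t \<in> carrier G \<and> inv\<^bsub>G\<^esub> t \<otimes>\<^bsub>G\<^esub> g \<in> K)" for g
    define \<eta> where "\<eta> g = \<psi> (inv\<^bsub>G\<^esub> r g \<otimes>\<^bsub>G\<^esub> g)" for g
    have r: "r g \<in> carrier G \<and> inv\<^bsub>G\<^esub> r g \<otimes>\<^bsub>G\<^esub> g \<in> K" if "g \<in> carrier G" for g
      unfolding r_def by (rule someI[where x = g]) (use that K subgroup.one_closed in auto)
    have r_mult: "r (g \<otimes>\<^bsub>G\<^esub> \<phi> h) = r g" if "g \<in> carrier G" "h \<in> carrier H" for g h
    proof -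
      have "inv\<^bsub>G\<^esub> t \<otimes>\<^bsub>G\<^esub> (g \<otimes>\<^bsub>G\<^esub> \<phi> h) \<in> K \<longleftrightarrow> inv\<^bsub>G\<^esub> t \<otimes>\<^bsub>G\<^esub> g \<in> K" if "t \<in> carrier G" for t
        using image_mult_iff[of "inv\<^bsub>G\<^esub> t \<otimes>\<^bsub>G\<^esub> g" h] that \<open>g \<in> _\<close> \<open>h \<in> _\<close>
        by (simp add: G.m_assoc K_def)
      then show ?thesis unfolding r_def by metis
    qed
    have \<eta>: "\<eta> g \<in> carrier H" if "g \<in> carrier G" for g
      using r[OF that] \<psi>_closed by (auto simp: \<eta>_def K_def)
    have \<eta>_mult: "\<eta> (g \<otimes>\<^bsub>G\<^esub> \<phi> h) = \<eta> g \<otimes>\<^bsub>H\<^esub> h" if "g \<in> carrier G" "h \<in> carrier H" for g h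
      using r[OF that(1)] \<psi>_mult(1)[of "inv\<^bsub>G\<^esub> r g \<otimes>\<^bsub>G\<^esub> g" h] that
      by (simp add: \<eta>_def r_mult K_def G.m_assoc)
    \<comment> \<open>The witness carries a copy of \<open>x\<close> on every left coset, and
      \<open>g \<mapsto> K g\<close> as second layer.\<close>
    define z where "z = (\<lambda>g\<in>carrier G. (x (\<eta> g), K #>\<^bsub>G\<^esub> g))"
    have xP: "x \<in> carrier H \<rightarrow>\<^sub>E A" and xQ: "\<And>h. h \<in> carrier H \<Longrightarrow> Q (\<lambda>w\<in>W. x (h \<otimes>\<^bsub>H\<^esub> w))"
      using x by (simp_all add: S)
    have "x (\<eta> g) \<in> A" "K #>\<^bsub>G\<^esub> g \<in> C" if "g \<in> carrier G" for g
      using PiE_mem[OF xP \<eta>[OF that]] G.rcosetsI[OF K(2) that] by (simp_all add: C_def)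
    then have "z \<in> carrier G \<rightarrow>\<^sub>E (A \<times> C)"
      by (simp add: z_def)
    moreover have "Q' (\<lambda>w\<in>W'. z (g \<otimes>\<^bsub>G\<^esub> w))" if g: "g \<in> carrier G" for g
    proof -
      have "(\<lambda>w\<in>W. fst (z (g \<otimes>\<^bsub>G\<^esub> \<phi> w))) = (\<lambda>w\<in>W. x (\<eta> g \<otimes>\<^bsub>H\<^esub> w))"
        using g W \<eta>_mult by (auto simp: z_def fun_eq_iff subset_eq)
      moreover have "snd (z (g \<otimes>\<^bsub>G\<^esub> s)) = snd (z g) #>\<^bsub>G\<^esub> s" if "s \<in> B" for s
      proof -
        have "s \<in> carrier G" using that B by auto
        then show ?thesis using g K(2) by (simp add: z_def G.coset_mult_assoc)
      qed
      ultimately show ?thesis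
        using xQ[OF \<eta>[OF g]] by (simp add: Q'_iff[OF g])
    qed
    ultimately show ?thesis by (auto simp: V_def)
  qed
  moreover have "finite (A \<times> C)" using A finite_index by (simp add: C_def K_def)
  ultimately obtain z k where z: "z \<in> V" and k: "k \<in> carrier G" "k \<noteq> \<one>\<^bsub>G\<^esub>"
    and zk: "\<And>g. g \<in> carrier G \<Longrightarrow> z (k \<otimes>\<^bsub>G\<^esub> g) = z g"
    using G.weakly_periodic_window[OF wp _ W' V_def] by blast
  have zP: "z \<in> carrier G \<rightarrow>\<^sub>E (A \<times> C)" using z by (simp add: V_def)
  have zC: "snd (z g) \<in> C" and zA: "fst (z g) \<in> A" if "g \<in> carrier G" for g
    using PiE_mem[OF zP that] by auto
  have zQ: "Q (\<lambda>w\<in>W. fst (z (g \<otimes>\<^bsub>G\<^esub> \<phi> w)))"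
    and zB: "\<And>s. s \<in> B \<Longrightarrow> snd (z (g \<otimes>\<^bsub>G\<^esub> s)) = snd (z g) #>\<^bsub>G\<^esub> s" if "g \<in> carrier G" for g
    using z that Q'_iff[OF that] by (auto simp: V_def)
  obtain a where a: "a \<in> carrier G" "snd (z \<one>\<^bsub>G\<^esub>) = K #>\<^bsub>G\<^esub> a"
    using zC[of "\<one>\<^bsub>G\<^esub>"] by (auto simp: C_def RCOSETS_def)
  \<comment> \<open>The second layer at \<open>k\<close> is computed twice: equivariance gives
    \<open>K a k\<close>, periodicity gives \<open>K a\<close>. Hence \<open>a k a^-1\<close> lies
    in \<open>K\<close>.\<close>
  have "snd (z (\<one>\<^bsub>G\<^esub> \<otimes>\<^bsub>G\<^esub> k)) = snd (z \<one>\<^bsub>G\<^esub>) #>\<^bsub>G\<^esub> k"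
    by (rule G.equivariant_on_generate[where B = B and c = "\<lambda>g. snd (z g)"])
      (use B k zB C[OF zC] in simp_all)
  moreover have "z k = z \<one>\<^bsub>G\<^esub>" using zk[of "\<one>\<^bsub>G\<^esub>"] k by simp
  ultimately have "K #>\<^bsub>G\<^esub> (a \<otimes>\<^bsub>G\<^esub> k) = K #>\<^bsub>G\<^esub> a"
    using a k K by (simp add: G.coset_mult_assoc)
  then have "K #>\<^bsub>G\<^esub> (a \<otimes>\<^bsub>G\<^esub> k \<otimes>\<^bsub>G\<^esub> inv\<^bsub>G\<^esub> a) = K"
    by (rule G.coset_mult_inv2) (use a k K in auto)
  then have "a \<otimes>\<^bsub>G\<^esub> k \<otimes>\<^bsub>G\<^esub> inv\<^bsub>G\<^esub> a \<in> K"
    by (rule G.coset_join1) (use a k K in auto)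
  then obtain l where l: "l \<in> carrier H" "\<phi> l = a \<otimes>\<^bsub>G\<^esub> k \<otimes>\<^bsub>G\<^esub> inv\<^bsub>G\<^esub> a"
    by (auto simp: K_def)
  \<comment> \<open>This identity turns left translation by \<open>l\<close> in \<open>H\<close>
    into left translation by the period \<open>k\<close> in \<open>G\<close>.\<close>
  have al: "inv\<^bsub>G\<^esub> a \<otimes>\<^bsub>G\<^esub> \<phi> l = k \<otimes>\<^bsub>G\<^esub> inv\<^bsub>G\<^esub> a"
    using a k by (simp add: l G.m_assoc[symmetric])
  \<comment> \<open>The first layer of \<open>z\<close> is read along the left coset
    \<open>a^-1 K\<close>; its windows there are windows of \<open>z\<close>, so \<open>Q\<close> is
    inherited.\<close>
  define y where "y = (\<lambda>h\<in>carrier H. fst (z (inv\<^bsub>G\<^esub> a \<otimes>\<^bsub>G\<^esub> \<phi> h)))"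
  have yP: "y \<in> carrier H \<rightarrow>\<^sub>E A" using zA a by (auto simp: y_def)
  moreover have "Q (\<lambda>w\<in>W. y (h \<otimes>\<^bsub>H\<^esub> w))" if h: "h \<in> carrier H" for h
  proof -
    have "(\<lambda>w\<in>W. y (h \<otimes>\<^bsub>H\<^esub> w)) = (\<lambda>w\<in>W. fst (z (inv\<^bsub>G\<^esub> a \<otimes>\<^bsub>G\<^esub> \<phi> h \<otimes>\<^bsub>G\<^esub> \<phi> w)))"
      using h W a by (auto simp: y_def fun_eq_iff subset_eq G.m_assoc)
    then show ?thesis using zQ a h by simp
  qed
  ultimately have "y \<in> S" by (simp add: S)
  moreover have "l \<noteq> \<one>\<^bsub>H\<^esub>"
  proof
    assume "l = \<one>\<^bsub>H\<^esub>"
    then have "k \<otimes>\<^bsub>G\<^esub> inv\<^bsub>G\<^esub> a = \<one>\<^bsub>G\<^esub> \<otimes>\<^bsub>G\<^esub> inv\<^bsub>G\<^esub> a" using al a by simp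
    then show False
      using k a(1) G.right_cancel[of "inv\<^bsub>G\<^esub> a" k "\<one>\<^bsub>G\<^esub>"] by blast
  qed
  moreover have "y (l \<otimes>\<^bsub>H\<^esub> h) = y h" if h: "h \<in> carrier H" for h
  proof -
    have "inv\<^bsub>G\<^esub> a \<otimes>\<^bsub>G\<^esub> \<phi> (l \<otimes>\<^bsub>H\<^esub> h) = k \<otimes>\<^bsub>G\<^esub> (inv\<^bsub>G\<^esub> a \<otimes>\<^bsub>G\<^esub> \<phi> h)"
      using al a k l(1) h by (simp flip: G.m_assoc)
    then show ?thesis using zk a h l(1) by (simp add: y_def)
  qed
  ultimately show "\<exists>x\<in>S. weakly_periodic_config H x"
    using H.weakly_periodic_config_iff[OF yP] l(1) by blast
qed

section \<open>Ascent to the overgroup by block coding\<close>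

lemma weakly_periodic_overgroup:
  assumes wp: "weakly_periodic_group H"
  shows "weakly_periodic_group G"
  unfolding weakly_periodic_group_def
proof (intro allI impI)
  fix A :: "nat set" and S
  assume "SFT G A S"
  then obtain W Q where A: "finite A" and ne: "S \<noteq> {}" and W: "finite W" "W \<subseteq> carrier G"
    and S: "S = {x \<in> carrier G \<rightarrow>\<^sub>E A. \<forall>g\<in>carrier G. Q (\<lambda>w\<in>W. x (g \<otimes>\<^bsub>G\<^esub> w))}"
    unfolding G.SFT_iff_window by blast
  define K where "K = \<phi> ` carrier H"
  have K: "subgroup K G" "K \<subseteq> carrier G"
    using image_subgroup subgroup.subset[OF image_subgroup] by (auto simp: K_def)
  \<comment> \<open>Right cosets are used here: \<open>g\<close> is \<open>\<phi> (\<eta> g)\<close>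
    times \<open>\<tau> g\<close>, with \<open>\<tau> g\<close> in the transversal \<open>T\<close>.
    Left multiplication by \<open>\<phi> h\<close> then fixes \<open>\<tau>\<close> and multiplies
    \<open>\<eta>\<close> by \<open>h\<close>, which is what lifting a period requires.\<close>
  define rep where "rep c = (SOME t. t \<in> c)" for c :: "'g set"
  define T where "T = rep ` (rcosets\<^bsub>G\<^esub> K)"
  define \<tau> where "\<tau> g = rep (K #>\<^bsub>G\<^esub> g)" for g
  define \<eta> where "\<eta> g = \<psi> (g \<otimes>\<^bsub>G\<^esub> inv\<^bsub>G\<^esub> \<tau> g)" for g
  have \<tau>_coset: "\<tau> g \<in> K #>\<^bsub>G\<^esub> g" if "g \<in> carrier G" for g
    unfolding \<tau>_def rep_def using G.rcos_self[OF that K(1)] by (rule someI)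
  have \<tau>: "\<tau> g \<in> T" "\<tau> g \<in> carrier G" if "g \<in> carrier G" for g
    using \<tau>_coset[OF that] G.rcosetsI[OF K(2) that] G.r_coset_subset_G[OF K(2) that]
    by (auto simp: T_def \<tau>_def)
  have T: "finite T" "T \<subseteq> carrier G"
    using finite_index \<tau>(2) by (auto simp: T_def K_def \<tau>_def RCOSETS_def)
  have K\<tau>: "g \<otimes>\<^bsub>G\<^esub> inv\<^bsub>G\<^esub> \<tau> g \<in> \<phi> ` carrier H" if g: "g \<in> carrier G" for g
  proof -
    have "K #>\<^bsub>G\<^esub> g = K #>\<^bsub>G\<^esub> \<tau> g"
      using G.repr_independence[OF \<tau>_coset[OF g] g K(1)] .
    then have "K #>\<^bsub>G\<^esub> (g \<otimes>\<^bsub>G\<^esub> inv\<^bsub>G\<^esub> \<tau> g) = K"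
      by (rule G.coset_mult_inv2) (use g \<tau> K in auto)
    then have "g \<otimes>\<^bsub>G\<^esub> inv\<^bsub>G\<^esub> \<tau> g \<in> K"
      by (rule G.coset_join1) (use g \<tau> K in auto)
    then show ?thesis by (simp add: K_def)
  qed
  have \<eta>: "\<eta> g \<in> carrier H" and decomp: "\<phi> (\<eta> g) \<otimes>\<^bsub>G\<^esub> \<tau> g = g" if "g \<in> carrier G" for g
    using K\<tau>[OF that] \<psi>_closed \<tau>(2)[OF that] that by (simp_all add: \<eta>_def \<phi>_\<psi> G.m_assoc)
  have \<tau>_mult: "\<tau> (\<phi> h \<otimes>\<^bsub>G\<^esub> g) = \<tau> g" if "h \<in> carrier H" "g \<in> carrier G" for h g
  proof -
    have "K #>\<^bsub>G\<^esub> \<phi> h = K" using that K by (intro G.coset_join2) (auto simp: K_def)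
    then have "K #>\<^bsub>G\<^esub> (\<phi> h \<otimes>\<^bsub>G\<^esub> g) = K #>\<^bsub>G\<^esub> g"
      using that K by (simp flip: G.coset_mult_assoc)
    then show ?thesis by (simp add: \<tau>_def)
  qed
  have \<eta>_mult: "\<eta> (\<phi> h \<otimes>\<^bsub>G\<^esub> g) = h \<otimes>\<^bsub>H\<^esub> \<eta> g" if "h \<in> carrier H" "g \<in> carrier G" for h g
    using \<psi>_mult(2)[OF K\<tau>[OF that(2)] that(1)] that \<tau>
    by (simp add: \<eta>_def \<tau>_mult G.m_assoc)
  \<comment> \<open>In block form, the letter at \<open>\<phi> h\<close> times \<open>t w\<close> is
    entry \<open>\<tau> (t w)\<close> of the block at \<open>h\<close> times
    \<open>\<eta> (t w)\<close>; \<open>W'\<close> collects these finitely many offsets.\<close>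
  define W' where "W' = (\<lambda>(t, w). \<eta> (t \<otimes>\<^bsub>G\<^esub> w)) ` (T \<times> W)"
  define Q' where "Q' = (\<lambda>q. \<forall>t\<in>T. Q (\<lambda>w\<in>W. q (\<eta> (t \<otimes>\<^bsub>G\<^esub> w)) (\<tau> (t \<otimes>\<^bsub>G\<^esub> w))))"
  define Y where "Y = {y \<in> carrier H \<rightarrow>\<^sub>E (T \<rightarrow>\<^sub>E A).
    \<forall>h\<in>carrier H. Q' (\<lambda>w\<in>W'. y (h \<otimes>\<^bsub>H\<^esub> w))}"
  have W': "finite W'" "W' \<subseteq> carrier H"
    using T W \<eta> by (auto simp: W'_def subset_eq)
  have Q'_iff: "Q' (\<lambda>w\<in>W'. y (h \<otimes>\<^bsub>H\<^esub> w)) \<longleftrightarrow>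
      (\<forall>t\<in>T. Q (\<lambda>w\<in>W. y (h \<otimes>\<^bsub>H\<^esub> \<eta> (t \<otimes>\<^bsub>G\<^esub> w)) (\<tau> (t \<otimes>\<^bsub>G\<^esub> w))))" for y h
  proof -
    have "(\<lambda>w\<in>W. (\<lambda>w\<in>W'. y (h \<otimes>\<^bsub>H\<^esub> w)) (\<eta> (t \<otimes>\<^bsub>G\<^esub> w)) (\<tau> (t \<otimes>\<^bsub>G\<^esub> w))) =
        (\<lambda>w\<in>W. y (h \<otimes>\<^bsub>H\<^esub> \<eta> (t \<otimes>\<^bsub>G\<^esub> w)) (\<tau> (t \<otimes>\<^bsub>G\<^esub> w)))" if "t \<in> T" for t
      using that by (force simp: W'_def fun_eq_iff)
    then show ?thesis by (simp add: Q'_def)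
  qed
  have "Y \<noteq> {}"
  proof -
    obtain x where x: "x \<in> S" using ne by blast
    \<comment> \<open>The block at \<open>h\<close> records \<open>x\<close> on the translate of
      \<open>T\<close> by \<open>\<phi> h\<close>.\<close>
    define y where "y = (\<lambda>h\<in>carrier H. \<lambda>t\<in>T. x (\<phi> h \<otimes>\<^bsub>G\<^esub> t))"
    have "y \<in> carrier H \<rightarrow>\<^sub>E (T \<rightarrow>\<^sub>E A)"
      using x T by (auto simp: y_def S subset_eq)
    moreover have "Q' (\<lambda>w\<in>W'. y (h \<otimes>\<^bsub>H\<^esub> w))" if h: "h \<in> carrier H" for h
      unfolding Q'_iff
    proof
      fix t assume t: "t \<in> T"
      have "y (h \<otimes>\<^bsub>H\<^esub> \<eta> (t \<otimes>\<^bsub>G\<^esub> w)) (\<tau> (t \<otimes>\<^bsub>G\<^esub> w)) = x (\<phi> h \<otimes>\<^bsub>G\<^esub> t \<otimes>\<^bsub>G\<^esub> w)"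
        if "w \<in> W" for w
      proof -
        have tw: "t \<in> carrier G" "w \<in> carrier G" "t \<otimes>\<^bsub>G\<^esub> w \<in> carrier G"
          using t that T W by auto
        then show ?thesis
          using h \<eta>[OF tw(3)] \<tau>[OF tw(3)] decomp[OF tw(3)] by (simp add: y_def G.m_assoc)
      qed
      then have "(\<lambda>w\<in>W. y (h \<otimes>\<^bsub>H\<^esub> \<eta> (t \<otimes>\<^bsub>G\<^esub> w)) (\<tau> (t \<otimes>\<^bsub>G\<^esub> w))) =
          (\<lambda>w\<in>W. x (\<phi> h \<otimes>\<^bsub>G\<^esub> t \<otimes>\<^bsub>G\<^esub> w))"
        by (auto simp: fun_eq_iff)
      moreover have "\<phi> h \<otimes>\<^bsub>G\<^esub> t \<in> carrier G" using h t T by auto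
      ultimately show "Q (\<lambda>w\<in>W. y (h \<otimes>\<^bsub>H\<^esub> \<eta> (t \<otimes>\<^bsub>G\<^esub> w)) (\<tau> (t \<otimes>\<^bsub>G\<^esub> w)))"
        using x by (simp add: S)
    qed
    ultimately show ?thesis by (auto simp: Y_def)
  qed
  moreover have "finite (T \<rightarrow>\<^sub>E A)" using A T by (simp add: finite_PiE)
  ultimately obtain y k where y: "y \<in> Y" and k: "k \<in> carrier H" "k \<noteq> \<one>\<^bsub>H\<^esub>"
    and yk: "\<And>h. h \<in> carrier H \<Longrightarrow> y (k \<otimes>\<^bsub>H\<^esub> h) = y h"
    using H.weakly_periodic_window[OF wp _ W' Y_def] by blast
  have yP: "y \<in> carrier H \<rightarrow>\<^sub>E (T \<rightarrow>\<^sub>E A)" using y by (simp add: Y_def)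
  \<comment> \<open>Blocks are reassembled into a configuration over \<open>G\<close>.\<close>
  define x where "x = (\<lambda>g\<in>carrier G. y (\<eta> g) (\<tau> g))"
  have xP: "x \<in> carrier G \<rightarrow>\<^sub>E A"
    using yP \<eta> \<tau>(1) by (auto simp: x_def intro: PiE_mem)
  moreover have "Q (\<lambda>w\<in>W. x (g \<otimes>\<^bsub>G\<^esub> w))" if g: "g \<in> carrier G" for g
  proof -
    have "x (g \<otimes>\<^bsub>G\<^esub> w) = y (\<eta> g \<otimes>\<^bsub>H\<^esub> \<eta> (\<tau> g \<otimes>\<^bsub>G\<^esub> w)) (\<tau> (\<tau> g \<otimes>\<^bsub>G\<^esub> w))" if "w \<in> W" for w
    proof -
      have w: "w \<in> carrier G" using that W by auto
      \<comment> \<open>Thus the window of \<open>x\<close> at \<open>g\<close> is governed by the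
        block rule at \<open>\<eta> g\<close>, in its instance \<open>t = \<tau> g\<close>.\<close>
      have "g \<otimes>\<^bsub>G\<^esub> w = \<phi> (\<eta> g) \<otimes>\<^bsub>G\<^esub> (\<tau> g \<otimes>\<^bsub>G\<^esub> w)"
        using decomp[OF g] \<eta>[OF g] \<tau>[OF g] w by (simp flip: G.m_assoc)
      then show ?thesis
        using g w \<eta>[OF g] \<tau>[OF g] by (simp add: x_def \<tau>_mult \<eta>_mult)
    qed
    then have "(\<lambda>w\<in>W. x (g \<otimes>\<^bsub>G\<^esub> w)) =
        (\<lambda>w\<in>W. y (\<eta> g \<otimes>\<^bsub>H\<^esub> \<eta> (\<tau> g \<otimes>\<^bsub>G\<^esub> w)) (\<tau> (\<tau> g \<otimes>\<^bsub>G\<^esub> w)))"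
      by (auto simp: fun_eq_iff)
    then show ?thesis
      using y \<eta>[OF g] \<tau>[OF g] by (simp add: Y_def Q'_iff)
  qed
  ultimately have "x \<in> S" by (simp add: S)
  moreover have "\<phi> k \<noteq> \<one>\<^bsub>G\<^esub>"
    using k inj_onD[OF inj, of k "\<one>\<^bsub>H\<^esub>"] by auto
  moreover have "x (\<phi> k \<otimes>\<^bsub>G\<^esub> g) = x g" if "g \<in> carrier G" for g
    using that k yk \<eta> by (simp add: x_def \<tau>_mult \<eta>_mult)
  ultimately show "\<exists>x\<in>S. weakly_periodic_config G x"
    using G.weakly_periodic_config_iff[OF xP] k(1) \<phi>_closed by blast
qed

end

section \<open>Commensurable groups\<close>

text \<open>Compose the inverse isomorphism from \<open>H\<close> to \<open>K\<close> with the
  inclusion of \<open>K\<close>.\<close>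

lemma (in group) finite_index_embedding_of_iso:
  assumes K: "finite_index_subgroup K G" and H: "group H" and iso: "G\<lparr>carrier := K\<rparr> \<cong> H"
  shows "\<exists>\<phi>. finite_index_embedding H G \<phi>"
proof -
  have sub: "subgroup K G" and fin: "finite (rcosets K)"
    using K by (auto simp: finite_index_subgroup_def)
  obtain \<phi> where \<phi>: "\<phi> \<in> iso H (G\<lparr>carrier := K\<rparr>)"
    using group.iso_sym[OF subgroup_imp_group[OF sub] iso] by (auto simp: is_iso_def)
  then have "\<phi> \<in> hom H G" "inj_on \<phi> (carrier H)" "\<phi> ` carrier H = K"
    using subgroup.subset[OF sub] by (auto simp: iso_iff hom_def)
  then have "finite_index_embedding H G \<phi>"
    using H fin by (simp add: finite_index_embedding_def finite_index_embedding_axioms_def group_axioms)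
  then show ?thesis by blast
qed

theorem theorem1:
  fixes G1 :: "('a, 'm) monoid_scheme" and G2 :: "('b, 'n) monoid_scheme"
  assumes "group G1" and "group G2"
    and "finitely_generated_group G1" and "finitely_generated_group G2"
    and "commensurable G1 G2"
    and "weakly_periodic_group G1"
  shows "weakly_periodic_group G2"
proof -
  obtain H :: "'a monoid" and K1 K2 where H: "group H"
    and K1: "finite_index_subgroup K1 G1" "G1\<lparr>carrier := K1\<rparr> \<cong> H"
    and K2: "finite_index_subgroup K2 G2" "G2\<lparr>carrier := K2\<rparr> \<cong> H"
    using assms(5) by (auto simp: commensurable_def)
  \<comment> \<open>Weak periodicity descends from \<open>G1\<close> to \<open>H\<close>, then
    ascends from \<open>H\<close> to \<open>G2\<close>.\<close>
  have "weakly_periodic_group H"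
    using group.finite_index_embedding_of_iso[OF assms(1) K1(1) H K1(2)]
      finite_index_embedding.weakly_periodic_subgroup assms(3,6) by blast
  then show ?thesis
    using group.finite_index_embedding_of_iso[OF assms(2) K2(1) H K2(2)]
      finite_index_embedding.weakly_periodic_overgroup by blast
qed

end
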